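(* Let $\mathcal{R}$ be a finite commutative ring with $1$ of characteristic $2$, meaning that $1+1=0$ in $\mathcal{R}$, and let $m\ge 1$. Then $\mathcal{I}(\mathcal{R},m)=|\mathcal{R}|^m$.
   Context: For $u,v\in\mathcal{R}^m$ let $d^2(u,v)=\sum_{i=1}^m(u_i-v_i)^2\in\mathcal{R}$. Two points are at integral distance if $d^2(u,v)=t^2$ for some $t\in\mathcal{R}$. An integral point set in $\mathcal{R}^m$ is a set of points pairwise at integral distance. For finite $\mathcal{R}$, $\mathcal{I}(\mathcal{R},m)$ denotes the maximum cardinality of an integral point set in $\mathcal{R}^m$. *)

theory Defs
  imports "HOL-Algebra.Ring"
begin

text \<open>
  Points of \<open>R\<^sup>m\<close> are extensional functions on \<open>{1..m}\<close> (value \<open>undefined\<close> elsewhere), so that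
  a point is determined by its \<open>m\<close> coordinates and cardinalities are those of \<open>R\<^sup>m\<close>.
\<close>

definition points :: "('a, 'b) ring_scheme \<Rightarrow> nat \<Rightarrow> (nat \<Rightarrow> 'a) set" where
  "points R m = {1..m} \<rightarrow>\<^sub>E carrier R"

definition sq_dist :: "('a, 'b) ring_scheme \<Rightarrow> nat \<Rightarrow> (nat \<Rightarrow> 'a) \<Rightarrow> (nat \<Rightarrow> 'a) \<Rightarrow> 'a" where
  "sq_dist R m u v = (\<Oplus>\<^bsub>R\<^esub>i\<in>{1..m}. (u i \<ominus>\<^bsub>R\<^esub> v i) [^]\<^bsub>R\<^esub> (2::nat))"

definition integral_distance ::
    "('a, 'b) ring_scheme \<Rightarrow> nat \<Rightarrow> (nat \<Rightarrow> 'a) \<Rightarrow> (nat \<Rightarrow> 'a) \<Rightarrow> bool" where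
  "integral_distance R m u v \<longleftrightarrow> (\<exists>t\<in>carrier R. sq_dist R m u v = t [^]\<^bsub>R\<^esub> (2::nat))"

definition integral_point_set :: "('a, 'b) ring_scheme \<Rightarrow> nat \<Rightarrow> (nat \<Rightarrow> 'a) set \<Rightarrow> bool" where
  "integral_point_set R m P \<longleftrightarrow> P \<subseteq> points R m \<and> pairwise (integral_distance R m) P"

text \<open>
  Only meaningful for finite \<open>carrier R\<close>: then the set of cardinalities is finite, and it is
  nonempty because the empty set is an integral point set, so \<open>Max\<close> is the true maximum.
\<close>

definition max_integral_card :: "('a, 'b) ring_scheme \<Rightarrow> nat \<Rightarrow> nat" where
  "max_integral_card R m = Max {card P | P. integral_point_set R m P}"

end

theory Submission
  imports Defs
begin

text \<open>In characteristic 2 squaring is additive (\<open>square_add_char2\<close>), so a finite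
  sum of squares is the square of the sum (\<open>finsum_square_char2\<close>). Hence the squared
  distance of any two points is a square (\<open>integral_distance_char2\<close>), and the whole
  space is itself an integral point set, necessarily the largest one.\<close>

lemma (in cring) square_add_char2:
  assumes "\<one> \<oplus> \<one> = \<zero>" "x \<in> carrier R" "y \<in> carrier R"
  shows "(x \<oplus> y) [^] (2::nat) = x [^] (2::nat) \<oplus> y [^] (2::nat)"
proof -
  \<comment> \<open>The cross term of the binomial expansion is a multiple of
    \<open>\<one> \<oplus> \<one>\<close>, hence vanishes.\<close>
  have "x \<otimes> y \<oplus> x \<otimes> y = (\<one> \<oplus> \<one>) \<otimes> (x \<otimes> y)"
    using assms(2,3) by (simp add: l_distr)
  then have cross: "x \<otimes> y \<oplus> x \<otimes> y = \<zero>"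
    using assms by simp
  have "(x \<oplus> y) [^] (2::nat) = x \<otimes> x \<oplus> (x \<otimes> y \<oplus> x \<otimes> y) \<oplus> y \<otimes> y"
    using assms(2,3) by (simp add: numeral_2_eq_2 l_distr r_distr m_comm a_ac)
  then show ?thesis
    using assms(2,3) cross by (simp add: numeral_2_eq_2)
qed

lemma (in cring) finsum_square_char2:
  assumes "\<one> \<oplus> \<one> = \<zero>" "finite A" "f \<in> A \<rightarrow> carrier R"
  shows "(\<Oplus>i\<in>A. f i [^] (2::nat)) = (\<Oplus>i\<in>A. f i) [^] (2::nat)"
  using assms(2,3)
proof (induction A rule: finite_induct)
  case empty
  then show ?case by (simp add: numeral_2_eq_2)
next
  case (insert a A)
  then have "f \<in> A \<rightarrow> carrier R" "f a \<in> carrier R" by auto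
  moreover from this have "(\<lambda>i. f i [^] (2::nat)) \<in> A \<rightarrow> carrier R" by auto
  ultimately show ?case
    using insert by (simp add: square_add_char2[OF assms(1)])
qed

lemma (in cring) integral_distance_char2:
  assumes "\<one> \<oplus> \<one> = \<zero>" "u \<in> points R m" "v \<in> points R m"
  shows "integral_distance R m u v"
proof -
  have d: "(\<lambda>i. u i \<ominus> v i) \<in> {1..m} \<rightarrow> carrier R"
    using assms(2,3) unfolding points_def by (auto dest: PiE_mem)
  show ?thesis
    unfolding integral_distance_def sq_dist_def
    \<comment> \<open>The witness \<open>t\<close> is the sum of the coordinate differences
      \<open>u i \<ominus> v i\<close>.\<close>
    using finsum_square_char2[OF assms(1) _ d] finsum_closed[OF d] by auto
qed

theorem lemma2:
  fixes R :: "('a, 'b) ring_scheme" and m :: nat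
  assumes "cring R"
    and "finite (carrier R)"
    and "\<one>\<^bsub>R\<^esub> \<oplus>\<^bsub>R\<^esub> \<one>\<^bsub>R\<^esub> = \<zero>\<^bsub>R\<^esub>"
    and "m \<ge> 1"
  shows "max_integral_card R m = card (carrier R) ^ m"
proof -
  have fin: "finite (points R m)"
    unfolding points_def by (intro finite_PiE) (auto simp: assms(2))
  \<comment> \<open>The pairwise condition always holds, so only containment in the space
    remains.\<close>
  have "integral_point_set R m P \<longleftrightarrow> P \<subseteq> points R m" for P
    unfolding integral_point_set_def pairwise_def
    using cring.integral_distance_char2[OF assms(1,3)] by blast
  then have "{card P | P. integral_point_set R m P} = card ` Pow (points R m)"
    by auto
  \<comment> \<open>The space is a subset of itself, and by finiteness no subset has more
    elements.\<close>
  moreover have "Max (card ` Pow (points R m)) = card (points R m)"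
    using fin by (intro Max_eqI) (auto intro: card_mono)
  ultimately show ?thesis
    by (simp add: max_integral_card_def points_def card_PiE)
qed

end
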